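(* For any $\mathbf{IL}_{\mathrm{set}}$-frame $F=\langle W,R,S\rangle$, we have $F\models\mathsf{P_0}$ if and only if $F$ is an $\mathbf{IL}_{\mathrm{set}}\mathsf{P_0}$-frame, where $\mathsf{P_0}$ is the schema $(A\rhd\Diamond B)\rightarrow\Box(A\rhd B)$.
   Context: Modal formulas are built from $\bot$ and countably many propositional variables using $\rightarrow$, the unary modality $\Box$ and the binary modality $\rhd$; other boolean connectives are defined as usual and $\Diamond A:=\neg\Box\neg A$. An $\mathbf{IL}_{\mathrm{set}}$-frame is a structure $\langle W,R,S\rangle$ where $W$ is a non-empty set, $R$ is a transitive and conversely well-founded binary relation on $W$ (every non-empty subset of $W$ has an $R$-maximal element), and $S\subseteq W\times W\times(\mathcal P(W)\setminus\{\emptyset\})$ satisfies, writing $yS_xY$ for $(x,y,Y)\in S$: (a) if $xS_wY$ then $wRx$ and $wRy$ for all $y\in Y$; (b) $wRx$ implies $xS_w\{x\}$; (c) if $xS_wY$, then for all $y\in Y$ and all $Z$: if $y\notin Z$ and $yS_wZ$ then $xS_wZ$; (d) $wRx$ and $xRy$ imply $xS_w\{y\}$. An $\mathbf{IL}_{\mathrm{set}}$-model based on such a frame is obtained by adding a relation $\Vdash$ between worlds and formulas that commutes with boolean connectives and satisfies: $w\Vdash\Box A$ iff $x\Vdash A$ for all $x$ with $wRx$; $w\Vdash A\rhd B$ iff for all $x$ with $wRx$ and $x\Vdash A$ there is $Y$ with $xS_wY$ and $y\Vdash B$ for all $y\in Y$. For a schema $\mathsf X$, $F\models\mathsf X$ means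 that every instance of $\mathsf X$ is true at every world of every model based on $F$. An $\mathbf{IL}_{\mathrm{set}}\mathsf{P_0}$-frame is an $\mathbf{IL}_{\mathrm{set}}$-frame such that for all $w,x,y\in W$ and $Y,Z\subseteq W$ with $wRx$, $xRy$, $yS_wY$ and such that for every $y'\in Y$ there is $z\in Z$ with $y'Rz$, there exists $Z'\subseteq Z$ with $yS_xZ'$. *)

theory Defs
  imports Main
begin

datatype fm =
    Var nat
  | Bot
  | Imp fm fm   (infixr "\<^bold>\<rightarrow>" 60)
  | Box fm      ("\<box> _" [80] 80)
  | Rhd fm fm   (infix "\<rhd>" 70)

abbreviation Neg :: "fm \<Rightarrow> fm"  ("\<^bold>\<not> _" [80] 80)
  where "\<^bold>\<not> A \<equiv> A \<^bold>\<rightarrow> Bot"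

abbreviation Dia :: "fm \<Rightarrow> fm"  ("\<diamond> _" [80] 80)
  where "\<diamond> A \<equiv> \<^bold>\<not> \<box> \<^bold>\<not> A"

text \<open>
  Throughout, \<open>(w, x, Y) \<in> S\<close> stands for \<open>x S\<^sub>w Y\<close>: the subscript comes first.
\<close>

locale il_set_frame =
  fixes W :: "'w set"
    and R :: "('w \<times> 'w) set"
    and S :: "('w \<times> 'w \<times> 'w set) set"
  assumes nonempty: "W \<noteq> {}"
    and R_on: "R \<subseteq> W \<times> W"
    and R_trans: "trans R"
    and R_conv_wf: "\<And>X. X \<subseteq> W \<Longrightarrow> X \<noteq> {} \<Longrightarrow> \<exists>m\<in>X. \<forall>y\<in>X. (m, y) \<notin> R"
    and S_on: "S \<subseteq> W \<times> W \<times> (Pow W - {{}})"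
    and S_R: "\<And>w x Y. (w, x, Y) \<in> S \<Longrightarrow> (w, x) \<in> R \<and> (\<forall>y\<in>Y. (w, y) \<in> R)"
    and S_refl: "\<And>w x. (w, x) \<in> R \<Longrightarrow> (w, x, {x}) \<in> S"
    and S_quasi_trans:
      "\<And>w x y Y Z. (w, x, Y) \<in> S \<Longrightarrow> y \<in> Y \<Longrightarrow> y \<notin> Z \<Longrightarrow> (w, y, Z) \<in> S \<Longrightarrow> (w, x, Z) \<in> S"
    and R_S: "\<And>w x y. (w, x) \<in> R \<Longrightarrow> (x, y) \<in> R \<Longrightarrow> (w, x, {y}) \<in> S"

text \<open>
  The values of \<open>V\<close> outside \<open>W\<close> are unconstrained; nothing below depends on them.
\<close>

locale il_set_model = il_set_frame W R S
  for W :: "'w set" and R S +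
  fixes V :: "'w \<Rightarrow> fm \<Rightarrow> bool"
  assumes forces_Bot: "\<And>w. w \<in> W \<Longrightarrow> \<not> V w Bot"
    and forces_Imp: "\<And>w A B. w \<in> W \<Longrightarrow> V w (A \<^bold>\<rightarrow> B) \<longleftrightarrow> (V w A \<longrightarrow> V w B)"
    and forces_Box: "\<And>w A. w \<in> W \<Longrightarrow> V w (\<box> A) \<longleftrightarrow> (\<forall>x. (w, x) \<in> R \<longrightarrow> V x A)"
    and forces_Rhd: "\<And>w A B. w \<in> W \<Longrightarrow> V w (A \<rhd> B) \<longleftrightarrow>
        (\<forall>x. (w, x) \<in> R \<and> V x A \<longrightarrow> (\<exists>Y. (w, x, Y) \<in> S \<and> (\<forall>y\<in>Y. V y B)))"

text \<open>A schema is identified with the set of its instances.\<close>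

definition frame_valid ::
    "'w set \<Rightarrow> ('w \<times> 'w) set \<Rightarrow> ('w \<times> 'w \<times> 'w set) set \<Rightarrow> fm set \<Rightarrow> bool" where
  "frame_valid W R S X \<longleftrightarrow> (\<forall>V. il_set_model W R S V \<longrightarrow> (\<forall>A\<in>X. \<forall>w\<in>W. V w A))"

definition P0 :: "fm set" where
  "P0 = {(A \<rhd> \<diamond> B) \<^bold>\<rightarrow> \<box> (A \<rhd> B) | A B. True}"

locale il_set_P0_frame = il_set_frame W R S
  for W :: "'w set" and R S +
  assumes P0_condition:
    "\<And>w x y Y Z. w \<in> W \<Longrightarrow> x \<in> W \<Longrightarrow> y \<in> W \<Longrightarrow> Y \<subseteq> W \<Longrightarrow> Z \<subseteq> W \<Longrightarrow>
      (w, x) \<in> R \<Longrightarrow> (x, y) \<in> R \<Longrightarrow> (w, y, Y) \<in> S \<Longrightarrow>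
      (\<forall>y'\<in>Y. \<exists>z\<in>Z. (y', z) \<in> R) \<Longrightarrow>
      \<exists>Z'. Z' \<subseteq> Z \<and> (x, y, Z') \<in> S"

end

theory Submission
  imports Defs
begin

text \<open>The frame condition is the schema read off one pair of propositions. For soundness
  (\<open>frame_valid_P0\<close>), the premise at \<open>w\<close> gives a set \<open>Y\<close> of
  worlds each seeing a \<open>B\<close>-world; the condition, with \<open>Z\<close> the set of
  \<open>B\<close>-worlds, turns this into the witness needed at \<open>x\<close>. Conversely
  (\<open>P0_frame_if_frame_valid\<close>), one variable is made true only at \<open>y\<close> and
  another exactly on \<open>Z\<close>: the premise then holds at \<open>w\<close> by the choice of
  \<open>Y\<close>, and the conclusion at \<open>x\<close> and \<open>y\<close> yields
  \<open>Z'\<close>.\<close>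

primrec sat ::
    "('w \<times> 'w) set \<Rightarrow> ('w \<times> 'w \<times> 'w set) set \<Rightarrow> (nat \<Rightarrow> 'w set) \<Rightarrow> 'w \<Rightarrow> fm \<Rightarrow> bool" where
  "sat R S v w (Var n) \<longleftrightarrow> w \<in> v n"
| "sat R S v w Bot \<longleftrightarrow> False"
| "sat R S v w (A \<^bold>\<rightarrow> B) \<longleftrightarrow> (sat R S v w A \<longrightarrow> sat R S v w B)"
| "sat R S v w (\<box> A) \<longleftrightarrow> (\<forall>x. (w, x) \<in> R \<longrightarrow> sat R S v x A)"
| "sat R S v w (A \<rhd> B) \<longleftrightarrow>
    (\<forall>x. (w, x) \<in> R \<and> sat R S v x A \<longrightarrow> (\<exists>Y. (w, x, Y) \<in> S \<and> (\<forall>y\<in>Y. sat R S v y B)))"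

text \<open>Models fix truth for all formulas at once; this turns any valuation of the variables
  into one, since the forcing clauses are the recursion equations of \<open>sat\<close>.\<close>

lemma (in il_set_frame) il_set_model_sat: "il_set_model W R S (sat R S v)"
  by unfold_locales simp_all

lemma (in il_set_model) forces_Dia:
  assumes "w \<in> W"
  shows "V w (\<diamond> A) \<longleftrightarrow> (\<exists>x. (w, x) \<in> R \<and> V x A)"
proof -
  have "V x (\<^bold>\<not> A) \<longleftrightarrow> \<not> V x A" if "(w, x) \<in> R" for x
    using that R_on forces_Imp forces_Bot by blast
  then show ?thesis
    using assms by (auto simp: forces_Imp forces_Bot forces_Box)
qed

lemma (in il_set_P0_frame) frame_valid_P0: "frame_valid W R S P0"
proof -
  have "V w ((A \<rhd> \<diamond> B) \<^bold>\<rightarrow> \<box> (A \<rhd> B))" if "il_set_model W R S V" and w: "w \<in> W" for V w A B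
  proof -
    interpret il_set_model W R S V by fact
    have "\<exists>Z'. (x, y, Z') \<in> S \<and> (\<forall>z\<in>Z'. V z B)"
      if AB: "V w (A \<rhd> \<diamond> B)" and wx: "(w, x) \<in> R" and xy: "(x, y) \<in> R" and yA: "V y A" for x y
    proof -
      have "(w, y) \<in> R"
        using R_trans wx xy by (rule transD)
      then obtain Y where Y: "(w, y, Y) \<in> S" and YB: "\<forall>y'\<in>Y. V y' (\<diamond> B)"
        using AB yA w forces_Rhd by blast
      have YW: "Y \<subseteq> W"
        using Y S_on by blast
      \<comment> \<open>This set plays the role of \<open>Z\<close>. It is cut down to
        \<open>W\<close> because \<open>P0_condition\<close> asks for \<open>Z \<subseteq> W\<close>
        and \<open>V\<close> is arbitrary outside \<open>W\<close>.\<close>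
      have "\<forall>y'\<in>Y. \<exists>z\<in>{z \<in> W. V z B}. (y', z) \<in> R"
        using YB YW R_on forces_Dia by blast
      moreover have "x \<in> W" "y \<in> W"
        using xy R_on by auto
      ultimately have "\<exists>Z'. Z' \<subseteq> {z \<in> W. V z B} \<and> (x, y, Z') \<in> S"
        using w YW wx xy Y by (intro P0_condition[of w x y Y]) auto
      then show ?thesis
        by blast
    qed
    moreover have "x \<in> W" if "(w, x) \<in> R" for x
      using that R_on by blast
    ultimately show ?thesis
      using w by (auto simp: forces_Imp forces_Box forces_Rhd)
  qed
  then show ?thesis
    unfolding frame_valid_def P0_def by blast
qed

lemma (in il_set_frame) P0_frame_if_frame_valid:
  assumes valid: "frame_valid W R S P0"
  shows "il_set_P0_frame W R S"
proof unfold_locales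
  fix w x y Y Z
  assume w: "w \<in> W" and wx: "(w, x) \<in> R" and xy: "(x, y) \<in> R" and Y: "(w, y, Y) \<in> S"
    and YZ: "\<forall>y'\<in>Y. \<exists>z\<in>Z. (y', z) \<in> R"
  define v where "v n = (if n = 0 then {y} else Z)" for n :: nat
  have "(Var 0 \<rhd> \<diamond> (Var 1)) \<^bold>\<rightarrow> \<box> (Var 0 \<rhd> Var 1) \<in> P0"
    unfolding P0_def by blast
  then have "sat R S v w ((Var 0 \<rhd> \<diamond> (Var 1)) \<^bold>\<rightarrow> \<box> (Var 0 \<rhd> Var 1))"
    using valid il_set_model_sat w unfolding frame_valid_def by blast
  \<comment> \<open>Only \<open>y\<close> satisfies \<open>Var 0\<close>, so \<open>Y\<close> is the
    one witness to supply; by \<open>YZ\<close> each of its members sees a world of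
    \<open>Z\<close>.\<close>
  moreover have "sat R S v w (Var 0 \<rhd> \<diamond> (Var 1))"
    using Y YZ by (fastforce simp: v_def)
  ultimately have "sat R S v x (Var 0 \<rhd> Var 1)"
    using wx by simp
  \<comment> \<open>Applied to the successor \<open>y\<close> of \<open>x\<close>; a set forcing
    \<open>Var 1\<close> throughout is a subset of \<open>Z\<close>.\<close>
  then show "\<exists>Z'. Z' \<subseteq> Z \<and> (x, y, Z') \<in> S"
    using xy by (auto simp: v_def)
qed

theorem lemma3p8:
  fixes W :: "'w set"
    and R :: "('w \<times> 'w) set"
    and S :: "('w \<times> 'w \<times> 'w set) set"
  assumes "il_set_frame W R S"
  shows "frame_valid W R S P0 \<longleftrightarrow> il_set_P0_frame W R S"
  using il_set_frame.P0_frame_if_frame_valid[OF assms] il_set_P0_frame.frame_valid_P0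
  by blast

end
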